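(* For every integer $t \ge 3$ there exists $\epsilon_t > 0$ with the following property. For every positive integer $n$ and every independent set $I \subset [t]^n$ of $K_t^n$ such that $\epsilon := 1 - t\mu(I) < \epsilon_t$, there exists an independent set $J \subset [t]^n$ of $K_t^n$ of maximum size (so $\mu(J) = 1/t$) such that \[ \mu(I \setminus J) \le 4\epsilon^{\eta(t)}, \qquad \text{where } \eta(t) = \frac{\log t}{\log t - \log(t-1)}. \]
   Context: $K_t^n$ is the graph with vertex set $[t]^n = \{1,\dots,t\}^n$ in which $x,y$ are adjacent iff $x_i \neq y_i$ for all $i \in [n]$. For $S \subseteq [t]^n$, $\mu(S) := |S|/t^n$. $\log$ is the natural logarithm. *)

theory Defs
  imports Complex_Main "HOL-Library.FuncSet"
begin

text \<open>A graph is given by its vertex set \<open>V\<close> and its adjacency relation \<open>adj\<close>.\<close>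

definition independent_set :: "'a set \<Rightarrow> ('a \<Rightarrow> 'a \<Rightarrow> bool) \<Rightarrow> 'a set \<Rightarrow> bool" where
  "independent_set V adj S \<longleftrightarrow> S \<subseteq> V \<and> (\<forall>x\<in>S. \<forall>y\<in>S. \<not> adj x y)"

definition maximum_independent_set :: "'a set \<Rightarrow> ('a \<Rightarrow> 'a \<Rightarrow> bool) \<Rightarrow> 'a set \<Rightarrow> bool" where
  "maximum_independent_set V adj S \<longleftrightarrow>
     independent_set V adj S \<and> (\<forall>T. independent_set V adj T \<longrightarrow> card T \<le> card S)"

text \<open>Elements of \<open>[t]\<^sup>n\<close> are functions on \<open>{1..n}\<close>, extended by \<open>undefined\<close> outside
  \<open>{1..n}\<close>, so that each tuple has exactly one representative.\<close>

definition cube :: "nat \<Rightarrow> nat \<Rightarrow> (nat \<Rightarrow> nat) set" where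
  "cube t n = {1..n} \<rightarrow>\<^sub>E {1..t}"

definition K_adj :: "nat \<Rightarrow> (nat \<Rightarrow> nat) \<Rightarrow> (nat \<Rightarrow> nat) \<Rightarrow> bool" where
  "K_adj n x y \<longleftrightarrow> (\<forall>i\<in>{1..n}. x i \<noteq> y i)"

definition mu :: "nat \<Rightarrow> nat \<Rightarrow> (nat \<Rightarrow> nat) set \<Rightarrow> real" where
  "mu t n S = real (card S) / real t ^ n"

definition eta :: "nat \<Rightarrow> real" where
  "eta t = ln (real t) / (ln (real t) - ln (real t - 1))"

end

theory Submission
  imports Defs
begin

text \<open>Let \<open>\<theta> = 1 / eta t\<close>, let \<open>N(A)\<close> be the set of neighbours of \<open>A\<close>, and let
  \<open>D(A) = \<mu>(N(A)) - \<mu>(A)\<^sup>\<theta>\<close>. Induction on the dimension gives \<open>D(A) \<ge> 0\<close>: if \<open>a \<ge> b\<close> are the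
  densities of the two largest slices in some direction, then \<open>\<mu>(N(A)) \<ge> ((t - 1) a\<^sup>\<theta> + b\<^sup>\<theta>) / t\<close>,
  which is at least \<open>((a + (t - 1) b) / t)\<^sup>\<theta>\<close>, with equality only for \<open>b = 0\<close> and \<open>b = a\<close>.

  An independent set \<open>I\<close> of density \<open>(1 - \<epsilon>) / t\<close> satisfies \<open>D(I) \<le> \<epsilon>\<close>. Rough stability: if
  \<open>\<mu>(A)\<close> is near \<open>1 / t\<close> and \<open>D(A)\<close> is small, then some slice of \<open>A\<close> has density more than
  \<open>1 - \<rho>\<close>. This is again an induction on the dimension. For \<open>t \<ge> 3\<close> the loss in the inequality
  above is at least linear in \<open>a - b\<close>, and this pays for the drift of the densities when passing
  to slices. If a slice of \<open>A\<close> is close to a dictatorship but \<open>A\<close> is not, then some other slice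
  of \<open>A\<close> is not close to the same dictatorship, and since \<open>t \<ge> 3\<close> some slice of \<open>N(A)\<close> contains
  the neighbourhoods of both, which together are too large.

  Finally let \<open>J\<close> be the dictatorship found for \<open>I\<close>, and let \<open>a\<close> be the largest density of a
  parallel slice of \<open>I\<close> outside \<open>J\<close>. Its neighbourhood is missing from the slice of \<open>I\<close> in \<open>J\<close>, so
  \<open>\<epsilon> \<ge> a\<^sup>\<theta> - (t - 1) a\<close>; as \<open>a\<close> is small and \<open>\<theta> < 1\<close>, this forces
  \<open>a \<le> 4 \<epsilon>\<^bsup>1/\<theta>\<^esup>\<close>.\<close>

section \<open>The two-slice inequality\<close>

locale alphabet =
  fixes t :: nat
  assumes t_ge_3: "3 \<le> t"
begin

text \<open>Fixing one coordinate gives a set of density \<open>1 / t\<close> whose neighbourhood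
  has density \<open>(t - 1) / t\<close>; this exponent makes such dictatorships equality cases of
  \<open>isoperimetry\<close>.\<close>

definition \<theta> :: real where
  "\<theta> = (ln (real t) - ln (real t - 1)) / ln (real t)"

lemma \<theta>_pos: "0 < \<theta>" and \<theta>_less_1: "\<theta> < 1"
proof -
  have "0 < ln (real t - 1)" "ln (real t - 1) < ln (real t)"
    using t_ge_3 by auto
  then show "0 < \<theta>" "\<theta> < 1"
    by (auto simp: \<theta>_def divide_simps)
qed

lemma eta_eq: "eta t = 1 / \<theta>"
  by (simp add: eta_def \<theta>_def)

lemma inverse_powr_\<theta>: "(1 / real t) powr \<theta> = (real t - 1) / real t"
proof -
  have "ln (real t) > 0" using t_ge_3 by simp
  then have "\<theta> * ln (real t) = ln (real t) - ln (real t - 1)"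
    by (simp add: \<theta>_def)
  then have "(1 / real t) powr \<theta> = exp (ln (real t - 1) - ln (real t))"
    using t_ge_3 by (simp add: powr_def ln_div)
  also have "\<dots> = (real t - 1) / real t"
    using t_ge_3 by (simp add: exp_diff)
  finally show ?thesis .
qed

lemma powr_\<theta>_ge: "x \<le> x powr \<theta>" if "0 \<le> x" "x \<le> 1"
  using powr_mono'[of \<theta> 1 x] that \<theta>_less_1 by (cases "x = 0") auto

lemma powr_\<theta>_le: "x powr \<theta> \<le> x" if "1 \<le> x"
  using powr_mono[of \<theta> 1 x] that \<theta>_less_1 by auto

text \<open>The loss in the two-slice inequality, normalised so that the largest slice has density 1
  and the second largest density \<open>x\<close>.\<close>

definition gap :: "real \<Rightarrow> real" where
  "gap x = (real t - 1 + x powr \<theta>) / t - ((1 + (real t - 1) * x) / t) powr \<theta>"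

lemma gap_0: "gap 0 = 0" and gap_1: "gap 1 = 0"
  using inverse_powr_\<theta> t_ge_3 by (auto simp: gap_def)

lemma continuous_gap: "continuous_on {0..1} gap"
  unfolding gap_def using \<theta>_pos t_ge_3
  by (intro continuous_on_diff continuous_on_divide continuous_on_add continuous_on_mult
      continuous_on_powr' continuous_on_const continuous_on_id) auto

definition gap' :: "real \<Rightarrow> real" where
  "gap' x = \<theta> / t * (x powr (\<theta> - 1) - (real t - 1) * ((1 + (real t - 1) * x) / t) powr (\<theta> - 1))"

lemma gap_deriv: "(gap has_real_derivative gap' x) (at x)" if "0 < x"
proof -
  have "0 < 1 + (real t - 1) * x"
    using that t_ge_3 by (intro add_pos_nonneg) auto
  then show ?thesis
    unfolding gap_def gap'_def using that t_ge_3
    by (auto intro!: derivative_eq_intros simp: field_simps)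
qed

lemma gap_pos: "0 < gap x" if x: "0 < x" "x < 1"
proof (rule ccontr)
  assume neg: "\<not> 0 < gap x"
  \<comment> \<open>\<open>gap'\<close> has the sign of \<open>R - (t - 1)\<close> with \<open>R\<close> decreasing, so \<open>gap\<close> first increases
    and then decreases between its zeros at \<open>0\<close> and \<open>1\<close>.\<close>
  define R where "R y = (real t * y / (1 + (real t - 1) * y)) powr (\<theta> - 1)" for y
  have den: "0 < 1 + (real t - 1) * y" if "0 < y" for y
    using that t_ge_3 by (intro add_pos_nonneg) auto
  have gap'_R: "gap' y = \<theta> / t * ((1 + (real t - 1) * y) / t) powr (\<theta> - 1) * (R y - (real t - 1))"
    if "0 < y" for y
  proof -
    have *: "(1 + (real t - 1) * y) / t * (real t * y / (1 + (real t - 1) * y)) = y"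
      using den[OF that] t_ge_3 by simp
    define P where "P = ((1 + (real t - 1) * y) / t) powr (\<theta> - 1)"
    have eq: "P * R y = y powr (\<theta> - 1)"
      unfolding R_def P_def using * that den[OF that] t_ge_3
      by (subst powr_mult[symmetric]) auto
    show ?thesis
      unfolding gap'_def eq[symmetric] P_def[symmetric] using t_ge_3 by (simp add: field_simps)
  qed
  have mvt_gap: "\<exists>z. a < z \<and> z < b \<and> gap b - gap a = (b - a) * gap' z" if "0 \<le> a" "a < b" "b \<le> 1" for a b
  proof -
    have "continuous_on {a..b} gap"
      using continuous_on_subset[OF continuous_gap] that by auto
    moreover have "(gap has_derivative (*) (gap' z)) (at z)" if "a < z" for z
      using gap_deriv[of z] \<open>0 \<le> a\<close> that by (simp add: has_field_derivative_def)
    ultimately show ?thesis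
      using mvt[of a b gap "\<lambda>z. (*) (gap' z)"] \<open>a < b\<close> by (metis mult.commute)
  qed
  have sign: "0 < \<theta> / t * ((1 + (real t - 1) * y) / t) powr (\<theta> - 1)" if "0 < y" for y
    using den[OF that] \<theta>_pos t_ge_3 by simp
  \<comment> \<open>If \<open>gap x\<close> were at most 0, the mean value theorem on either side of
    \<open>x\<close> would give slopes in the wrong order: nonpositive at \<open>z1\<close>,
    nonnegative at \<open>z2\<close>.\<close>
  obtain z1 where z1: "0 < z1" "z1 < x" "gap x - gap 0 = (x - 0) * gap' z1"
    using mvt_gap[of 0 x] x by auto
  then have "gap' z1 \<le> 0"
    using neg gap_0 x by (simp add: not_less mult_le_0_iff)
  then have R1: "R z1 \<le> real t - 1"
    using gap'_R[of z1] sign[of z1] z1 by (smt (verit) mult_pos_pos)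
  obtain z2 where z2: "x < z2" "z2 < 1" "gap 1 - gap x = (1 - x) * gap' z2"
    using mvt_gap[of x 1] x by auto
  then have "0 \<le> gap' z2"
    using neg gap_1 x by (smt (verit) mult_pos_neg)
  then have R2: "real t - 1 \<le> R z2"
    using gap'_R[of z2] sign[of z2] z2 x by (smt (verit) mult_pos_neg)
  have "real t * z1 / (1 + (real t - 1) * z1) < real t * z2 / (1 + (real t - 1) * z2)"
    using z1 z2 den[of z1] den[of z2] t_ge_3 by (simp add: divide_simps algebra_simps)
  then have "R z2 < R z1"
    unfolding R_def using z1 z2 den[of z1] \<theta>_less_1 t_ge_3 
    by (intro powr_less_mono2_neg) auto
  with R1 R2 show False by simp
qed

lemma gap_nonneg: "0 \<le> gap x" if "0 \<le> x" "x \<le> 1"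
  using gap_pos[of x] gap_0 gap_1 that by (cases "x = 0 \<or> x = 1") auto

lemma gap_linear_lower_bound:
  assumes "0 < x0" "x0 \<le> 1"
  obtains c where "0 < c" "\<And>x. x0 \<le> x \<Longrightarrow> x \<le> 1 \<Longrightarrow> c * (1 - x) \<le> gap x"
proof -
  \<comment> \<open>The continuous extension of \<open>gap x / (x - 1)\<close> is negative on \<open>[x0, 1]\<close>; at \<open>1\<close> this
    needs \<open>t > 2\<close>.\<close>
  define q where "q x = (if x = 1 then gap' 1 else (gap x - gap 1) / (x - 1))" for x
  have "continuous_on {x0..1} q"
    unfolding continuous_on_eq_continuous_within
  proof
    fix x assume x: "x \<in> {x0..1}"
    show "continuous (at x within {x0..1}) q"
    proof (cases "x = 1")
      case True
      have "((\<lambda>y. (gap y - gap 1) / (y - 1)) \<longlongrightarrow> gap' 1) (at 1)"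
        using gap_deriv[of 1] by (simp add: has_field_derivative_iff)
      then have "(q \<longlongrightarrow> q 1) (at 1)"
        by (subst tendsto_cong[where g = "\<lambda>y. (gap y - gap 1) / (y - 1)"])
          (auto simp: q_def eventually_at_filter)
      then show ?thesis
        using True by (auto simp: continuous_within intro: tendsto_within_subset)
    next
      case False
      then have "isCont gap x"
        using gap_deriv[of x] x assms by (auto intro: DERIV_isCont)
      then have "isCont (\<lambda>y. (gap y - gap 1) / (y - 1)) x"
        using False by (intro continuous_intros) auto
      moreover have "eventually (\<lambda>y. (gap y - gap 1) / (y - 1) = q y) (nhds x)"
        using t1_space_nhds[OF False] by eventually_elim (simp add: q_def)
      ultimately have "isCont q x"
        by (simp add: isCont_cong)
      then show ?thesis
        by (simp add: continuous_at_imp_continuous_at_within)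
    qed
  qed
  moreover have "compact {x0..1}" "{x0..1} \<noteq> {}"
    using assms by auto
  ultimately obtain x1 where x1: "x1 \<in> {x0..1}" "\<forall>x\<in>{x0..1}. - q x \<ge> - q x1"
    using continuous_attains_sup by force
  show thesis
  proof
    have "gap' 1 < 0"
      using t_ge_3 \<theta>_pos by (simp add: gap'_def field_simps)
    then show "0 < - q x1"
      using gap_pos[of x1] x1 assms by (auto simp: q_def gap_1 divide_simps)
    show "- q x1 * (1 - x) \<le> gap x" if "x0 \<le> x" "x \<le> 1" for x
    proof (cases "x = 1")
      case False
      then have "q x = - (gap x / (1 - x))"
        using minus_divide_right[of "gap x" "1 - x"] by (simp add: q_def gap_1)
      then have "- q x1 \<le> gap x / (1 - x)"
        using bspec[OF x1(2), of x] that by simp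
      then show ?thesis
        using False that by (simp add: field_simps)
    qed (simp add: gap_1)
  qed
qed

text \<open>Both terms are homogeneous of degree \<open>\<theta>\<close> in \<open>m\<close> and
  \<open>b\<close>, so only the ratio \<open>b / m\<close> matters.\<close>

lemma gap_scaled:
  assumes "0 < m" "0 \<le> b"
  shows "((real t - 1) * m powr \<theta> + b powr \<theta>) / t - ((m + (real t - 1) * b) / t) powr \<theta>
    = m powr \<theta> * gap (b / m)"
proof -
  have "(m + (real t - 1) * b) / t = m * ((1 + (real t - 1) * (b / m)) / t)"
    using assms t_ge_3 by (simp add: divide_simps)
  then have "((m + (real t - 1) * b) / t) powr \<theta> = m powr \<theta> * ((1 + (real t - 1) * (b / m)) / t) powr \<theta>"
    by (simp only: powr_mult)
  moreover have "b powr \<theta> = m powr \<theta> * (b / m) powr \<theta>"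
    using assms by (simp add: powr_divide)
  ultimately show ?thesis
    by (simp add: gap_def algebra_simps add_divide_distrib diff_divide_distrib)
qed

text \<open>Here \<open>m\<close> and \<open>b\<close> stand for the two largest slice densities and
  \<open>a\<close> for the density of the whole set; this drives the induction in
  \<open>isoperimetry\<close>.\<close>

lemma powr_average_le:
  assumes "0 \<le> b" "b \<le> m" "0 \<le> a" "a \<le> (m + (real t - 1) * b) / t"
  shows "a powr \<theta> \<le> ((real t - 1) * m powr \<theta> + b powr \<theta>) / t"
proof (cases "m = 0")
  case False
  then have "0 \<le> m powr \<theta> * gap (b / m)"
    using assms by (intro mult_nonneg_nonneg gap_nonneg) auto
  then have "((m + (real t - 1) * b) / t) powr \<theta> \<le> ((real t - 1) * m powr \<theta> + b powr \<theta>) / t"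
    using gap_scaled[of m b] assms False by simp
  moreover have "a powr \<theta> \<le> ((m + (real t - 1) * b) / t) powr \<theta>"
    using assms \<theta>_pos by (intro powr_mono2) auto
  ultimately show ?thesis by simp
qed (use assms in auto)

text \<open>The derivative \<open>\<theta> * z powr (\<theta> - 1)\<close> is at least
  \<open>\<theta>\<close> for \<open>0 < z \<le> 1\<close>, because
  \<open>\<theta> < 1\<close>.\<close>

lemma powr_\<theta>_diff_ge:
  assumes "0 \<le> a" "a \<le> m" "m \<le> 1"
  shows "\<theta> * (m - a) \<le> m powr \<theta> - a powr \<theta>"
proof (cases "a = m")
  case False
  have "continuous_on {a..m} (\<lambda>x. x powr \<theta>)"
    using \<theta>_pos assms by (intro continuous_on_powr' continuous_intros) auto
  moreover have "((\<lambda>x. x powr \<theta>) has_derivative (*) (\<theta> * z powr (\<theta> - 1))) (at z)" if "a < z" for z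
    using that assms by (auto intro!: derivative_eq_intros simp: has_field_derivative_def[symmetric])
  ultimately obtain z where z: "a < z" "z < m" "m powr \<theta> - a powr \<theta> = \<theta> * z powr (\<theta> - 1) * (m - a)"
    using mvt[of a m "\<lambda>x. x powr \<theta>" "\<lambda>z. (*) (\<theta> * z powr (\<theta> - 1))"] False assms by auto
  have "1 powr (\<theta> - 1) \<le> z powr (\<theta> - 1)"
    using z assms \<theta>_less_1 by (intro powr_mono2') auto
  then have "\<theta> * 1 * (m - a) \<le> \<theta> * z powr (\<theta> - 1) * (m - a)"
    using assms \<theta>_pos by (intro mult_right_mono mult_left_mono) auto
  with z show ?thesis by simp
qed simp

text \<open>Since \<open>m \<le> 1 - \<rho>\<close> while the average \<open>a\<close> is near \<open>1 / t\<close>, the ratio \<open>b / m\<close> stays away from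
  the zero of \<open>gap\<close> at \<open>0\<close>.\<close>

lemma powr_average_deficit:
  assumes \<rho>: "0 < \<rho>" "\<rho> < 1"
  obtains c where "0 < c" "c \<le> 1"
    "\<And>a b m. \<lbrakk>0 \<le> b; b \<le> m; m \<le> 1 - \<rho>; a \<le> m; (1 - \<rho> / 2) / t \<le> a;
        a \<le> (m + (real t - 1) * b) / t\<rbrakk>
      \<Longrightarrow> c * (m - min a b) \<le> ((real t - 1) * m powr \<theta> + b powr \<theta>) / t - a powr \<theta>"
proof -
  define x0 where "x0 = \<rho> / (2 * real t)"
  have "0 < x0" "x0 \<le> 1"
    using \<rho> t_ge_3 by (auto simp: x0_def field_simps)
  then obtain c0 where c0: "0 < c0" "\<And>x. x0 \<le> x \<Longrightarrow> x \<le> 1 \<Longrightarrow> c0 * (1 - x) \<le> gap x"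
    using gap_linear_lower_bound by blast
  \<comment> \<open>\<open>c0\<close> serves the case \<open>b < a\<close> and the last entry the
    case \<open>a \<le> b\<close>; the bound 1 later keeps \<open>d \<le> e\<close> in the rough
    stability proof.\<close>
  define c where "c = min 1 (min c0 ((real t - 1) / t * \<theta>))"
  have c: "0 < c" "c \<le> 1" "c \<le> c0" "c \<le> (real t - 1) / t * \<theta>"
    using c0 \<theta>_pos t_ge_3 by (auto simp: c_def)
  show thesis
  proof
    fix a b m :: real
    assume *: "0 \<le> b" "b \<le> m" "m \<le> 1 - \<rho>" "a \<le> m" "(1 - \<rho> / 2) / t \<le> a"
      "a \<le> (m + (real t - 1) * b) / t"
    have "0 < (1 - \<rho> / 2) / t" using \<rho> t_ge_3 by simp
    then have "0 < a" "0 < m" using * by linarith+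
    show "c * (m - min a b) \<le> ((real t - 1) * m powr \<theta> + b powr \<theta>) / t - a powr \<theta>"
    proof (cases "b < a")
      case True
      \<comment> \<open>\<open>m\<close> is at least \<open>\<rho> / 2\<close> short of the
        left-hand side, so the other slices must supply that much.\<close>
      have "1 - \<rho> / 2 \<le> m + (real t - 1) * b"
        using order_trans[OF *(5,6)] t_ge_3 by (simp add: divide_le_cancel)
      then have "\<rho> / 2 \<le> (real t - 1) * b" using * by linarith
      also have "\<dots> \<le> real t * b" using * by (simp add: algebra_simps)
      finally have "x0 \<le> b" using t_ge_3 by (simp add: x0_def field_simps)
      also have "b \<le> b / m"
        using * \<open>0 < m\<close> \<rho> by (simp add: le_divide_eq mult_left_le)
      finally have "c0 * (1 - b / m) \<le> gap (b / m)"
        using * \<open>0 < m\<close> by (intro c0) auto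
      then have "m powr \<theta> * (c0 * (1 - b / m)) \<le> m powr \<theta> * gap (b / m)"
        by (intro mult_left_mono) auto
      moreover have "m * (c * (1 - b / m)) \<le> m powr \<theta> * (c0 * (1 - b / m))"
        using * \<open>0 < m\<close> c \<rho> powr_\<theta>_ge[of m] by (intro mult_mono) auto
      moreover have "m * (c * (1 - b / m)) = c * (m - b)"
        using \<open>0 < m\<close> by (simp add: field_simps)
      ultimately have "c * (m - b) \<le> 
          ((real t - 1) * m powr \<theta> + b powr \<theta>) / t - ((m + (real t - 1) * b) / t) powr \<theta>"
        using gap_scaled[of m b] \<open>0 < m\<close> * by linarith
      moreover have "a powr \<theta> \<le> ((m + (real t - 1) * b) / t) powr \<theta>"
        using * \<open>0 < a\<close> \<theta>_pos by (intro powr_mono2) auto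
      ultimately show ?thesis using True by simp
    next
      case False
      \<comment> \<open>Replacing \<open>b\<close> by the smaller \<open>a\<close> leaves
        \<open>(t - 1) / t\<close> times the difference of the powers of \<open>m\<close> and
        \<open>a\<close>.\<close>
      have "c * (m - a) \<le> (real t - 1) / t * \<theta> * (m - a)"
        using c * by (intro mult_right_mono) auto
      also have "\<dots> \<le> (real t - 1) / t * (m powr \<theta> - a powr \<theta>)"
        using powr_\<theta>_diff_ge[of a m] * \<open>0 < a\<close> \<rho> t_ge_3 
        by (simp only: mult.assoc) (intro mult_left_mono, auto)
      also have "\<dots> = ((real t - 1) * m powr \<theta> + a powr \<theta>) / t - a powr \<theta>"
        using t_ge_3 by (simp add: field_simps)
      also have "\<dots> \<le> ((real t - 1) * m powr \<theta> + b powr \<theta>) / t - a powr \<theta>"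
        using powr_mono2[of \<theta> a b] \<theta>_pos \<open>0 < a\<close> False by (simp add: divide_right_mono)
      finally show ?thesis using False by simp
    qed
  qed (use c in auto)
qed

section \<open>Slices and neighbourhoods\<close>

definition T :: "nat set" where "T = {1..t}"

lemma finite_T [simp]: "finite T" and card_T [simp]: "card T = t"
  by (auto simp: T_def)

text \<open>Coordinates are indexed by an arbitrary set, so that inductions can delete any
  coordinate without renumbering.\<close>

definition grid :: "nat set \<Rightarrow> (nat \<Rightarrow> nat) set" where
  "grid S = S \<rightarrow>\<^sub>E T"

definition dens :: "nat set \<Rightarrow> (nat \<Rightarrow> nat) set \<Rightarrow> real" where
  "dens S A = real (card A) / real t ^ card S"

definition nb :: "nat set \<Rightarrow> (nat \<Rightarrow> nat) set \<Rightarrow> (nat \<Rightarrow> nat) set" where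
  "nb S A = {y \<in> grid S. \<exists>x\<in>A. \<forall>i\<in>S. x i \<noteq> y i}"

text \<open>Fixing the coordinate \<open>i\<close> to \<open>v\<close> and then forgetting it; resetting it to \<open>undefined\<close> makes a
  slice of a subset of \<open>grid S\<close> a subset of \<open>grid (S - {i})\<close>.\<close>

definition slice :: "nat \<Rightarrow> nat \<Rightarrow> (nat \<Rightarrow> nat) set \<Rightarrow> (nat \<Rightarrow> nat) set" where
  "slice i v A = {y. y i = undefined \<and> y(i := v) \<in> A}"

lemma finite_grid: "finite S \<Longrightarrow> finite (grid S)"
  by (simp add: grid_def finite_PiE)

lemma card_grid: "finite S \<Longrightarrow> card (grid S) = t ^ card S"
  by (simp add: grid_def card_PiE)

lemma nb_subset: "nb S A \<subseteq> grid S"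
  by (auto simp: nb_def)

lemma dens_nonneg: "0 \<le> dens S A"
  by (simp add: dens_def)

lemma dens_empty [simp]: "dens S {} = 0"
  by (simp add: dens_def)

lemma dens_grid: "finite S \<Longrightarrow> dens S (grid S) = 1"
  using t_ge_3 by (simp add: dens_def card_grid)

lemma dens_mono: "\<lbrakk>A \<subseteq> B; B \<subseteq> grid S; finite S\<rbrakk> \<Longrightarrow> dens S A \<le> dens S B"
  unfolding dens_def using finite_subset[OF _ finite_grid]
  by (intro divide_right_mono) (auto intro: card_mono)

lemma dens_le_1: "\<lbrakk>A \<subseteq> grid S; finite S\<rbrakk> \<Longrightarrow> dens S A \<le> 1"
  using dens_mono[of A "grid S" S] by (simp add: dens_grid)

lemma dens_disjoint:
  assumes "A \<subseteq> grid S" "B \<subseteq> grid S" "finite S" "A \<inter> B = {}"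
  shows "dens S A + dens S B \<le> 1"
proof -
  have "card (A \<union> B) = card A + card B"
    using assms finite_subset[OF _ finite_grid] by (intro card_Un_disjoint) auto
  then have "dens S A + dens S B = dens S (A \<union> B)"
    by (simp add: dens_def add_divide_distrib)
  then show ?thesis
    using dens_le_1[of "A \<union> B" S] assms by auto
qed

lemma slice_mono: "A \<subseteq> B \<Longrightarrow> slice i v A \<subseteq> slice i v B"
  by (auto simp: slice_def)

lemma slice_commute: "i \<noteq> j \<Longrightarrow> slice i v (slice j w A) = slice j w (slice i v A)"
  by (auto simp: slice_def fun_upd_twist)

lemma slice_subset:
  assumes "A \<subseteq> grid S" "i \<in> S"
  shows "slice i v A \<subseteq> grid (S - {i})"
proof
  fix y assume y: "y \<in> slice i v A"
  then have *: "y(i := v) \<in> grid S" using assms by (auto simp: slice_def)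
  have "y j \<in> T" if "j \<in> S - {i}" for j
    using * that by (auto simp: grid_def PiE_iff split: if_splits)
  moreover have "y j = undefined" if "j \<notin> S - {i}" for j
    using * y that by (cases "j = i") (auto simp: grid_def PiE_iff extensional_def slice_def)
  ultimately show "y \<in> grid (S - {i})"
    by (auto simp: grid_def PiE_iff extensional_def)
qed

lemma card_slices:
  assumes "A \<subseteq> grid S" "i \<in> S" "finite S"
  shows "card A = (\<Sum>v\<in>T. card (slice i v A))"
proof -
  have A: "A = (\<Union>v\<in>T. (\<lambda>y. y(i := v)) ` slice i v A)"
  proof
    show "A \<subseteq> (\<Union>v\<in>T. (\<lambda>y. y(i := v)) ` slice i v A)"
    proof
      fix x assume x: "x \<in> A"
      then have "x i \<in> T" using assms by (auto simp: grid_def PiE_iff)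
      moreover have "x(i := undefined) \<in> slice i (x i) A"
        using x by (simp add: slice_def)
      then have "x \<in> (\<lambda>y. y(i := x i)) ` slice i (x i) A"
        by (rule rev_image_eqI) simp
      ultimately show "x \<in> (\<Union>v\<in>T. (\<lambda>y. y(i := v)) ` slice i v A)" by blast
    qed
  qed (auto simp: slice_def)
  have fin: "finite (slice i v A)" for v
    using finite_subset[OF slice_subset[OF assms(1,2)] finite_grid] assms(3) by simp
  have "card A = (\<Sum>v\<in>T. card ((\<lambda>y. y(i := v)) ` slice i v A))"
  proof (subst A, rule card_UN_disjoint)
    have "f(i := v) \<noteq> g(i := w)" if "v \<noteq> w" for f g :: "nat \<Rightarrow> nat" and v w
      using that by (metis fun_upd_same)
    then show "\<forall>v\<in>T. \<forall>w\<in>T. v \<noteq> w \<longrightarrow>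
        (\<lambda>y. y(i := v)) ` slice i v A \<inter> (\<lambda>y. y(i := w)) ` slice i w A = {}"
      by blast
  qed (use fin in auto)
  also have "\<dots> = (\<Sum>v\<in>T. card (slice i v A))"
  proof (intro sum.cong refl card_image inj_onI)
    fix v y z assume "y \<in> slice i v A" "z \<in> slice i v A" "y(i := v) = z(i := v)"
    then show "y = z"
      by (metis (mono_tags, lifting) fun_upd_triv fun_upd_upd mem_Collect_eq slice_def)
  qed
  finally show ?thesis .
qed

lemma dens_slices:
  assumes "A \<subseteq> grid S" "i \<in> S" "finite S"
  shows "dens S A = (\<Sum>v\<in>T. dens (S - {i}) (slice i v A)) / t"
proof -
  have "t ^ card S = t * t ^ card (S - {i})"
    using card.remove[OF assms(3,2)] by simp
  then show ?thesis
    unfolding dens_def card_slices[OF assms]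
    by (simp add: sum_divide_distrib[symmetric] flip: of_nat_power)
qed

text \<open>Adjacency splits over coordinates: coordinate \<open>i\<close> demands
  \<open>w \<noteq> v\<close>, the others demand adjacency in the smaller grid.\<close>

lemma slice_nb:
  assumes "A \<subseteq> grid S" "i \<in> S" "v \<in> T"
  shows "slice i v (nb S A) = (\<Union>w\<in>T - {v}. nb (S - {i}) (slice i w A))"
proof
  show "slice i v (nb S A) \<subseteq> (\<Union>w\<in>T - {v}. nb (S - {i}) (slice i w A))"
  proof
    fix y assume y: "y \<in> slice i v (nb S A)"
    then obtain x where x: "x \<in> A" "\<forall>j\<in>S. x j \<noteq> (y(i := v)) j"
      by (auto simp: slice_def nb_def)
    have "x i \<in> T - {v}"
      using x assms by (fastforce simp: grid_def PiE_iff)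
    moreover have "y \<in> grid (S - {i})"
      using slice_subset[OF nb_subset assms(2)] y by blast
    moreover have "x(i := undefined) \<in> slice i (x i) A"
      using x by (simp add: slice_def)
    moreover have "\<forall>j\<in>S - {i}. (x(i := undefined)) j \<noteq> y j"
      using x by auto
    ultimately show "y \<in> (\<Union>w\<in>T - {v}. nb (S - {i}) (slice i w A))"
      unfolding nb_def by blast
  qed
  show "(\<Union>w\<in>T - {v}. nb (S - {i}) (slice i w A)) \<subseteq> slice i v (nb S A)"
  proof
    fix y assume "y \<in> (\<Union>w\<in>T - {v}. nb (S - {i}) (slice i w A))"
    then obtain w x where w: "w \<in> T" "w \<noteq> v" "y \<in> grid (S - {i})" "x \<in> slice i w A"
      "\<forall>j\<in>S - {i}. x j \<noteq> y j"
      unfolding nb_def by blast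
    have "y i = undefined" 
      using w by (auto simp: grid_def PiE_iff extensional_def)
    moreover have "y(i := v) \<in> grid S"
      using w assms by (auto simp: grid_def PiE_iff extensional_def)
    moreover have "x(i := w) \<in> A" "\<forall>j\<in>S. (x(i := w)) j \<noteq> (y(i := v)) j"
      using w by (auto simp: slice_def)
    ultimately show "y \<in> slice i v (nb S A)"
      unfolding slice_def nb_def by blast
  qed
qed

lemma dens_slice_nb_mono:
  assumes "A \<subseteq> grid S" "i \<in> S" "finite S" "v \<in> T" "B \<subseteq> (\<Union>w\<in>T - {v}. nb (S - {i}) (slice i w A))"
  shows "dens (S - {i}) B \<le> dens (S - {i}) (slice i v (nb S A))"
  using assms slice_subset[OF nb_subset, of i S v A] by (intro dens_mono) (auto simp: slice_nb)

lemma sum_T_split: "v \<in> T \<Longrightarrow> (\<Sum>w\<in>T. f w) = f v + (\<Sum>w\<in>T - {v}. f w)" for f :: "nat \<Rightarrow> real"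
  by (rule sum.remove) auto

lemma card_T_remove: "v \<in> T \<Longrightarrow> real (card (T - {v})) = real t - 1"
  using t_ge_3 by (simp add: of_nat_diff)

lemma T_remove_nonempty: "v \<in> T \<Longrightarrow> T - {v} \<noteq> {}"
  using card_T_remove[of v] t_ge_3 by fastforce

text \<open>Each of the \<open>t - 1\<close> slices of \<open>nb S A\<close> away from
  \<open>p\<close> contains the neighbourhood of slice \<open>p\<close> of \<open>A\<close>, and the
  slice at \<open>p\<close> contains that of slice \<open>q\<close>.\<close>

lemma dens_nb_ge:
  assumes "A \<subseteq> grid S" "i \<in> S" "finite S" "p \<in> T" "q \<in> T" "p \<noteq> q"
  shows "((real t - 1) * dens (S - {i}) (nb (S - {i}) (slice i p A))
      + dens (S - {i}) (nb (S - {i}) (slice i q A))) / t \<le> dens S (nb S A)"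
proof -
  let ?d = "\<lambda>v. dens (S - {i}) (slice i v (nb S A))"
  let ?n = "\<lambda>v. dens (S - {i}) (nb (S - {i}) (slice i v A))"
  have "?n q \<le> ?d p"
    using assms by (intro dens_slice_nb_mono) auto
  moreover have "(\<Sum>v\<in>T - {p}. ?n p) \<le> (\<Sum>v\<in>T - {p}. ?d v)"
    using assms by (intro sum_mono dens_slice_nb_mono) auto
  moreover have "(\<Sum>v\<in>T - {p}. ?n p) = (real t - 1) * ?n p"
    using card_T_remove[OF assms(4)] by simp
  ultimately have "(real t - 1) * ?n p + ?n q \<le> (\<Sum>v\<in>T. ?d v)"
    using sum_T_split[OF assms(4), of ?d] by linarith
  then show ?thesis
    using assms t_ge_3 by (simp add: dens_slices[OF nb_subset assms(2,3)] divide_right_mono)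
qed

lemma argmax_on:
  assumes "finite X" "X \<noteq> {}"
  obtains p where "p \<in> X" "\<And>v. v \<in> X \<Longrightarrow> f v \<le> (f p :: real)"
proof -
  have "Max (f ` X) \<in> f ` X" using assms by simp
  then obtain p where "p \<in> X" "f p = Max (f ` X)" by auto
  then show ?thesis using that assms by (metis Max_ge finite_imageI imageI)
qed

lemma two_largest:
  fixes f :: "nat \<Rightarrow> real"
  obtains p q where "p \<in> T" "q \<in> T" "p \<noteq> q" "f q \<le> f p" "\<And>v. v \<in> T \<Longrightarrow> f v \<le> f p"
    "(\<Sum>v\<in>T. f v) \<le> f p + (real t - 1) * f q"
proof -
  have "T \<noteq> {}" using t_ge_3 by (auto simp: T_def)
  then obtain p where p: "p \<in> T" "\<And>v. v \<in> T \<Longrightarrow> f v \<le> f p"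
    using argmax_on[OF finite_T, of f] by blast
  obtain q where q: "q \<in> T - {p}" "\<And>v. v \<in> T - {p} \<Longrightarrow> f v \<le> f q"
    using argmax_on[of "T - {p}" f] T_remove_nonempty[OF p(1)] by auto
  have "(\<Sum>v\<in>T - {p}. f v) \<le> (\<Sum>v\<in>T - {p}. f q)"
    using q by (intro sum_mono) auto
  then have "(\<Sum>v\<in>T. f v) \<le> f p + (real t - 1) * f q"
    using sum_T_split[OF p(1), of f] card_T_remove[OF p(1)] by simp
  then show ?thesis using that p q by blast
qed

section \<open>The isoperimetric inequality\<close>

lemma grid_empty: "grid {} = {\<lambda>_. undefined}"
  by (simp add: grid_def)

lemma isoperimetry: "\<lbrakk>finite S; A \<subseteq> grid S\<rbrakk> \<Longrightarrow> dens S A powr \<theta> \<le> dens S (nb S A)"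
proof (induction S arbitrary: A rule: finite_induct)
  case empty
  \<comment> \<open>In dimension 0 adjacency holds vacuously, so the single point is its own
    neighbour and both densities are 0 or 1.\<close>
  then have "A = {} \<or> A = grid {}" by (auto simp: grid_empty)
  then show ?case by (auto simp: nb_def grid_empty dens_def)
next
  case (insert i F)
  let ?S = "insert i F" and ?a = "\<lambda>v. dens F (slice i v A)"
  have F: "?S - {i} = F" using insert by auto
  have fin: "finite ?S" using insert by simp
  have sub: "slice i v A \<subseteq> grid F" for v
    using slice_subset[OF insert.prems, of i v] F by simp
  obtain p q where pq: "p \<in> T" "q \<in> T" "p \<noteq> q" "?a q \<le> ?a p"
    "(\<Sum>v\<in>T. ?a v) \<le> ?a p + (real t - 1) * ?a q"
    using two_largest[of ?a] by metis
  have "dens ?S A = (\<Sum>v\<in>T. ?a v) / t"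
    using dens_slices[OF insert.prems _ fin, of i] F by simp
  then have "dens ?S A powr \<theta> \<le> ((real t - 1) * ?a p powr \<theta> + ?a q powr \<theta>) / t"
    using pq dens_nonneg[of ?S A] by (intro powr_average_le) (auto intro!: divide_right_mono dens_nonneg)
  also have "\<dots> \<le> ((real t - 1) * dens F (nb F (slice i p A)) + dens F (nb F (slice i q A))) / t"
    using t_ge_3 insert.IH[OF sub] by (intro divide_right_mono add_mono mult_left_mono) auto
  also have "\<dots> \<le> dens ?S (nb ?S A)"
    using dens_nb_ge[OF insert.prems _ fin pq(1,2,3), of i] F by simp
  finally show ?case .
qed

text \<open>The set and its neighbourhood are disjoint, yet a density above \<open>1 / t\<close>
  would force a neighbourhood of density at least \<open>(t - 1) / t\<close>.\<close>

lemma dens_independent_le: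
  assumes "finite S" "A \<subseteq> grid S" "A \<inter> nb S A = {}"
  shows "dens S A \<le> 1 / t"
proof (rule ccontr)
  assume "\<not> ?thesis"
  then have less: "1 / t < dens S A" by simp
  then have "(1 / t) powr \<theta> \<le> dens S A powr \<theta>"
    using \<theta>_pos by (intro powr_mono2) auto
  also have "\<dots> \<le> dens S (nb S A)"
    by (rule isoperimetry[OF assms(1,2)])
  also have "\<dots> \<le> 1 - dens S A"
    using dens_disjoint[OF assms(2) nb_subset assms(1,3)] by simp
  finally show False
    using less t_ge_3 inverse_powr_\<theta> by (simp add: field_simps)
qed

section \<open>Rough stability\<close>

text \<open>As in \<open>dens_nb_ge\<close>, but with the two slices taken from different sets. It
  will show that two sets concentrated on different values of a coordinate have a large joint
  neighbourhood.\<close>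

lemma dens_nb_Un_ge:
  assumes "finite S" "A \<subseteq> grid S" "B \<subseteq> grid S" "i \<in> S" "v \<in> T" "w \<in> T" "w \<noteq> v"
  shows "((real t - 1) * dens (S - {i}) (slice i v A) powr \<theta> + dens (S - {i}) (slice i w B) powr \<theta>) / t
    \<le> dens S (nb S A \<union> nb S B)"
proof -
  let ?U = "nb S A \<union> nb S B" and ?S' = "S - {i}"
  have U: "?U \<subseteq> grid S" using nb_subset by auto
  have fin: "finite ?S'" using assms by simp
  have ge: "dens ?S' (slice i u C) powr \<theta> \<le> dens ?S' (slice i z ?U)"
    if "C = A \<or> C = B" "u \<in> T" "z \<in> T" "u \<noteq> z" for C u z
  proof -
    have C: "C \<subseteq> grid S" using that assms by auto
    have "dens ?S' (slice i u C) powr \<theta> \<le> dens ?S' (nb ?S' (slice i u C))"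
      using isoperimetry[OF fin slice_subset[OF C assms(4)]] .
    also have "\<dots> \<le> dens ?S' (slice i z (nb S C))"
      using that C assms by (intro dens_slice_nb_mono) auto
    also have "\<dots> \<le> dens ?S' (slice i z ?U)"
      using that slice_mono[of "nb S C" ?U i z] slice_subset[OF U assms(4)] fin
      by (intro dens_mono) auto
    finally show ?thesis .
  qed
  have "(\<Sum>z\<in>T - {v}. dens ?S' (slice i v A) powr \<theta>) \<le> (\<Sum>z\<in>T - {v}. dens ?S' (slice i z ?U))"
    using assms by (intro sum_mono ge) auto
  moreover have "(\<Sum>z\<in>T - {v}. dens ?S' (slice i v A) powr \<theta>) = (real t - 1) * dens ?S' (slice i v A) powr \<theta>"
    using card_T_remove[OF assms(5)] by simp
  moreover have "dens ?S' (slice i w B) powr \<theta> \<le> dens ?S' (slice i v ?U)"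
    using assms by (intro ge) auto
  ultimately show ?thesis
    unfolding dens_slices[OF U assms(4,1)] using sum_T_split[OF assms(5), of "\<lambda>z. dens ?S' (slice i z ?U)"]
    by (intro divide_right_mono) auto
qed

text \<open>The allowance shrinks linearly with the distance of the density from
  \<open>1 / t\<close>. This form closes the induction: passing to a slice shifts the density, which
  costs no more than the loss from \<open>powr_average_deficit\<close>. The condition on
  \<open>\<rho>\<close> holds for small \<open>\<rho>\<close> since
  \<open>\<theta> < 1\<close>.\<close>

lemma near_extremal_has_dense_slice:
  fixes \<rho> :: real
  assumes \<rho>: "0 < \<rho>" "\<rho> < 1" "2 * t * \<rho> \<le> (\<rho> / (2 * t)) powr \<theta>"
  obtains c d where "0 < c" "0 < d"
    "\<And>S A. \<lbrakk>finite S; A \<subseteq> grid S;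
        dens S (nb S A) - dens S A powr \<theta> < d - c * \<bar>dens S A - 1 / t\<bar>\<rbrakk>
      \<Longrightarrow> \<exists>i\<in>S. \<exists>v\<in>T. 1 - \<rho> < dens (S - {i}) (slice i v A)"
proof -
  obtain c where c: "0 < c" "c \<le> 1"
    "\<And>a b m. \<lbrakk>0 \<le> b; b \<le> m; m \<le> 1 - \<rho>; a \<le> m; (1 - \<rho> / 2) / t \<le> a;
        a \<le> (m + (real t - 1) * b) / t\<rbrakk>
      \<Longrightarrow> c * (m - min a b) \<le> ((real t - 1) * m powr \<theta> + b powr \<theta>) / t - a powr \<theta>"
    using powr_average_deficit[OF \<rho>(1,2)] by blast
  have t: "3 \<le> real t" using t_ge_3 by simp
  \<comment> \<open>Chosen so that \<open>t * t * e = \<rho> / 8\<close>, which the closing estimate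
    needs; \<open>d = c * e\<close> confines the density to within \<open>e\<close> of
    \<open>1 / t\<close>.\<close>
  define e where "e = \<rho> / (8 * real t ^ 2)"
  define d where "d = c * e"
  have e: "0 < e" using \<rho> t by (simp add: e_def)
  have tte: "real t * (real t * e) = \<rho> / 8"
    using t by (simp add: e_def power2_eq_square)
  have te: "real t * e \<le> \<rho> / 8"
    using mult_right_mono[of 1 "real t" "real t * e"] tte e t by simp
  have d: "0 < d" "d \<le> e"
    using c e by (simp_all add: d_def mult_left_le_one_le)
  have step: "\<exists>j\<in>S. \<exists>v\<in>T. 1 - \<rho> < dens (S - {j}) (slice j v A)"
    if fin: "finite S" and A: "A \<subseteq> grid S" and i: "i \<in> S"
      and small: "dens S (nb S A) - dens S A powr \<theta> < d - c * \<bar>dens S A - 1 / t\<bar>"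
      and IH: "\<And>B. \<lbrakk>B \<subseteq> grid (S - {i});
          dens (S - {i}) (nb (S - {i}) B) - dens (S - {i}) B powr \<theta> < d - c * \<bar>dens (S - {i}) B - 1 / t\<bar>\<rbrakk>
        \<Longrightarrow> \<exists>j\<in>S - {i}. \<exists>v\<in>T. 1 - \<rho> < dens (S - {i} - {j}) (slice j v B)"
    for S A i
  proof (rule ccontr)
    assume contra: "\<not> ?thesis"
    define F where "F = S - {i}"
    define x where "x v = dens F (slice i v A)" for v
    define N where "N v = dens F (nb F (slice i v A))" for v
    define a where "a = dens S A"
    have finF: "finite F" using fin by (simp add: F_def)
    have sub: "slice i v A \<subseteq> grid F" for v
      unfolding F_def by (rule slice_subset[OF A i])
    have iso: "x v powr \<theta> \<le> N v" for v
      unfolding x_def N_def by (rule isoperimetry[OF finF sub])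
    obtain p q where pq: "p \<in> T" "q \<in> T" "p \<noteq> q" "x q \<le> x p" "\<And>v. v \<in> T \<Longrightarrow> x v \<le> x p"
      "(\<Sum>v\<in>T. x v) \<le> x p + (real t - 1) * x q"
      using two_largest[of x] by metis
    have a_avg: "a = (\<Sum>v\<in>T. x v) / t"
      unfolding a_def x_def F_def by (rule dens_slices[OF A i fin])
    have x_nonneg: "0 \<le> x v" for v by (simp add: x_def dens_nonneg)
    have "(\<Sum>v\<in>T. x v) \<le> (\<Sum>v\<in>T. x p)" using pq by (intro sum_mono) auto
    then have a_le: "a \<le> x p" using t by (simp add: a_avg field_simps)
    have xp: "x p \<le> 1 - \<rho>"
      using contra i pq(1) unfolding x_def F_def by force
    have "0 \<le> dens S (nb S A) - a powr \<theta>"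
      using isoperimetry[OF fin A] by (simp add: a_def)
    then have "c * \<bar>a - 1 / t\<bar> < c * e"
      using small by (simp add: a_def d_def)
    then have a_near: "\<bar>a - 1 / t\<bar> < e" using c by simp
    have "e \<le> \<rho> / 2 / t"
      using t \<rho> by (simp add: e_def power2_eq_square divide_simps)
    then have a_ge: "(1 - \<rho> / 2) / t \<le> a"
      using a_near by (simp add: diff_divide_distrib)
    define loss where "loss = ((real t - 1) * x p powr \<theta> + x q powr \<theta>) / t - a powr \<theta>"
    have loss: "c * (x p - min a (x q)) \<le> loss"
      unfolding loss_def using pq a_le xp a_ge t x_nonneg
      by (intro c(3)) (auto simp: a_avg intro!: divide_right_mono)
    have nb_ge: "((real t - 1) * N p + N q) / t \<le> dens S (nb S A)"
      unfolding N_def F_def by (rule dens_nb_ge[OF A i fin pq(1-3)])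
    have "((real t - 1) * x p powr \<theta> + x q powr \<theta>) / t \<le> ((real t - 1) * N p + N q) / t"
      using t iso by (intro divide_right_mono add_mono mult_left_mono) auto
    then have "loss < d - c * \<bar>a - 1 / t\<bar>"
      using nb_ge small by (simp add: loss_def a_def)
    moreover have "0 \<le> c * \<bar>a - 1 / t\<bar>" using c by simp
    ultimately have "c * (x p - min a (x q)) < c * e"
      using loss by (simp add: d_def)
    then have osc: "x p - min a (x q) < e" using c by simp
    \<comment> \<open>If the induction hypothesis applied to neither slice, both excesses
      \<open>N u - x u powr \<theta>\<close> would be at least \<open>k\<close> below; their
      weighted mean plus \<open>loss\<close> would then exceed the excess of
      \<open>A\<close>.\<close>
    have "\<exists>u\<in>{p, q}. \<exists>j\<in>F. \<exists>v\<in>T. 1 - \<rho> < dens (F - {j}) (slice j v (slice i u A))"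
    proof (rule ccontr)
      assume none: "\<not> ?thesis"
      have deficit: "d - c * \<bar>a - 1 / t\<bar> - c * (x p - min a (x q)) \<le> N u - x u powr \<theta>" if u: "u \<in> {p, q}" for u
      proof -
        have "\<not> N u - x u powr \<theta> < d - c * \<bar>x u - 1 / t\<bar>"
          using IH[of "slice i u A"] sub[of u] none u unfolding N_def x_def F_def by blast
        moreover have "\<bar>x u - 1 / t\<bar> \<le> \<bar>a - 1 / t\<bar> + (x p - min a (x q))"
          using u a_le pq(4) by auto
        then have "c * \<bar>x u - 1 / t\<bar> \<le> c * (\<bar>a - 1 / t\<bar> + (x p - min a (x q)))"
          using c by (intro mult_left_mono) auto
        ultimately show ?thesis by (simp add: distrib_left)
      qed
      define k where "k = d - c * \<bar>a - 1 / t\<bar> - c * (x p - min a (x q))"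
      have "((real t - 1) * k + k) / t \<le> ((real t - 1) * (N p - x p powr \<theta>) + (N q - x q powr \<theta>)) / t"
        using deficit t unfolding k_def by (intro divide_right_mono add_mono mult_left_mono) auto
      moreover have "((real t - 1) * k + k) / t = k" using t by (simp add: field_simps)
      moreover have "((real t - 1) * (N p - x p powr \<theta>) + (N q - x q powr \<theta>)) / t
          = ((real t - 1) * N p + N q) / t - (loss + a powr \<theta>)"
        using t by (simp add: loss_def field_simps)
      ultimately have "k \<le> dens S (nb S A) - a powr \<theta> - loss"
        using nb_ge by linarith
      then show False
        using small loss by (simp add: k_def a_def)
    qed
    then obtain u j v where u: "u \<in> {p, q}" and j: "j \<in> F" and v: "v \<in> T"
      and dense: "1 - \<rho> < dens (F - {j}) (slice j v (slice i u A))"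
      by blast
    have "j \<noteq> i" "j \<in> S" using j by (auto simp: F_def)
    have Sj: "S - {j} - {i} = F - {j}" by (auto simp: F_def)
    \<comment> \<open>Slice \<open>u\<close> is close to the dictatorship \<open>j = v\<close>, but
      \<open>A\<close> is not, so averaging over coordinate \<open>i\<close> yields a slice
      \<open>r\<close> that is not.\<close>
    have "dens (S - {j}) (slice j v A) \<le> 1 - \<rho>"
      using contra \<open>j \<in> S\<close> v by force
    moreover have "dens (S - {j}) (slice j v A) = (\<Sum>w\<in>T. dens (F - {j}) (slice j v (slice i w A))) / t"
      using dens_slices[OF slice_subset[OF A \<open>j \<in> S\<close>], of i v] i fin \<open>j \<noteq> i\<close>
      by (simp add: Sj slice_commute[of j i])
    ultimately have "(\<Sum>w\<in>T. dens (F - {j}) (slice j v (slice i w A))) \<le> t * (1 - \<rho>)"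
      using t by (simp add: field_simps)
    then obtain r where r: "r \<in> T" "dens (F - {j}) (slice j v (slice i r A)) \<le> 1 - \<rho>"
      using sum_strict_mono[of T "\<lambda>_. 1 - \<rho>" "\<lambda>w. dens (F - {j}) (slice j v (slice i w A))"] pq(1)
      by (force simp: not_le)
    have "u \<noteq> r" using r dense by auto
    have "u \<in> T" using u pq by auto
    \<comment> \<open>The maximum exceeds the average by less than \<open>e\<close>, so no single
      slice can lie far below the average.\<close>
    have "(\<Sum>w\<in>T - {r}. x w) \<le> (\<Sum>w\<in>T - {r}. x p)" using pq by (intro sum_mono) auto
    then have "t * a \<le> x r + (real t - 1) * x p"
      using sum_T_split[OF r(1), of x] card_T_remove[OF r(1)] t by (simp add: a_avg)
    moreover have "x p \<le> a + e" using osc by linarith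
    then have "(real t - 1) * x p \<le> (real t - 1) * (a + e)" using t by (intro mult_left_mono) auto
    ultimately have "a - (real t - 1) * e \<le> x r" by (simp add: algebra_simps)
    then have xr: "1 / t - t * e \<le> x r" using a_near by (simp add: algebra_simps)
    \<comment> \<open>Slice \<open>r\<close> has density about \<open>1 / t\<close>, of which value
      \<open>v\<close> of coordinate \<open>j\<close> contributes at most
      \<open>(1 - \<rho>) / t\<close>; some other value carries a fair share of the rest.\<close>
    have "\<exists>w\<in>T - {v}. \<rho> / (2 * t) \<le> dens (F - {j}) (slice j w (slice i r A))"
    proof (rule ccontr)
      let ?f = "\<lambda>w. dens (F - {j}) (slice j w (slice i r A))"
      assume "\<not> ?thesis"
      then have "(\<Sum>w\<in>T - {v}. ?f w) \<le> (\<Sum>w\<in>T - {v}. \<rho> / (2 * t))"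
        by (intro sum_mono) force
      also have "\<dots> = (real t - 1) * (\<rho> / (2 * t))"
        using card_T_remove[OF v] by simp
      also have "\<dots> < \<rho> / 2" using t \<rho> by (simp add: field_simps)
      finally have "(\<Sum>w\<in>T. ?f w) < 1 - \<rho> / 2"
        using r(2) sum_T_split[OF v, of ?f] by simp
      moreover have "x r = (\<Sum>w\<in>T. ?f w) / t"
        unfolding x_def by (rule dens_slices[OF sub j finF])
      moreover have "1 - \<rho> / 8 \<le> t * x r"
        using mult_left_mono[OF xr, of t] t tte by (simp add: right_diff_distrib)
      ultimately show False using t \<rho> by simp
    qed
    then obtain w where w: "w \<in> T" "w \<noteq> v" "\<rho> / (2 * t) \<le> dens (F - {j}) (slice j w (slice i r A))"
      by blast
    define U where "U = dens F (nb F (slice i u A) \<union> nb F (slice i r A))"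
    \<comment> \<open>The condition on \<open>\<rho>\<close> turns the small slice at
      \<open>w\<close> into a gain of \<open>2 * t * \<rho>\<close>, enough to leave a surplus
      \<open>\<rho>\<close> over the extremal value \<open>(t - 1) / t\<close>.\<close>
    have "((real t - 1) * (1 - \<rho>) + 2 * t * \<rho>) / t
        \<le> ((real t - 1) * dens (F - {j}) (slice j v (slice i u A)) powr \<theta>
          + dens (F - {j}) (slice j w (slice i r A)) powr \<theta>) / t"
    proof (intro divide_right_mono add_mono mult_left_mono)
      have "1 - \<rho> \<le> (1 - \<rho>) powr \<theta>" using \<rho> by (intro powr_\<theta>_ge) auto
      also have "\<dots> \<le> dens (F - {j}) (slice j v (slice i u A)) powr \<theta>"
        using \<rho> dense \<theta>_pos by (intro powr_mono2) auto
      finally show "1 - \<rho> \<le> dens (F - {j}) (slice j v (slice i u A)) powr \<theta>" .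
      have "(\<rho> / (2 * t)) powr \<theta> \<le> dens (F - {j}) (slice j w (slice i r A)) powr \<theta>"
        using \<rho> w \<theta>_pos by (intro powr_mono2) auto
      then show "2 * t * \<rho> \<le> dens (F - {j}) (slice j w (slice i r A)) powr \<theta>"
        using \<rho> by simp
    qed (use t in auto)
    also have "\<dots> \<le> U"
      unfolding U_def by (rule dens_nb_Un_ge[OF finF sub sub j v w(1,2)])
    finally have U: "(real t - 1) / t + \<rho> \<le> U"
      using t \<rho> by (simp add: field_simps)
    have xq: "x q powr \<theta> \<le> dens F (slice i z (nb S A))" if z: "z \<in> T" for z
    proof -
      \<comment> \<open>A slice of density at least \<open>x q\<close> at a value other than
        \<open>z\<close>.\<close>
      define y where "y = (if z = p then q else p)"
      have "x q powr \<theta> \<le> x y powr \<theta>"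
        using pq x_nonneg \<theta>_pos by (intro powr_mono2) (auto simp: y_def)
      also have "\<dots> \<le> dens F (nb F (slice i y A))" using iso[of y] by (simp add: N_def)
      also have "\<dots> \<le> dens F (slice i z (nb S A))"
        unfolding F_def using pq z A i fin by (intro dens_slice_nb_mono) (auto simp: y_def)
      finally show ?thesis .
    qed
    \<comment> \<open>A third value \<open>z\<close> exists because \<open>t \<ge> 3\<close>; slice
      \<open>z\<close> of \<open>nb S A\<close> contains both neighbourhoods counted in
      \<open>U\<close>.\<close>
    have "card {u, r} < card T" using t_ge_3 card_insert_le_m1[of 2 "{r}" u] by simp
    then have "\<not> T \<subseteq> {u, r}" using card_mono[of "{u, r}" T] by auto
    then obtain z where z: "z \<in> T" "z \<noteq> u" "z \<noteq> r" by auto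
    have "U \<le> dens F (slice i z (nb S A))"
      unfolding F_def U_def using A i fin z r \<open>u \<in> T\<close> by (intro dens_slice_nb_mono) (auto simp: F_def)
    moreover have "(\<Sum>y\<in>T - {z}. x q powr \<theta>) \<le> (\<Sum>y\<in>T - {z}. dens F (slice i y (nb S A)))"
      using xq by (intro sum_mono) auto
    ultimately have "U + (real t - 1) * x q powr \<theta> \<le> (\<Sum>y\<in>T. dens F (slice i y (nb S A)))"
      using sum_T_split[OF z(1), of "\<lambda>y. dens F (slice i y (nb S A))"] card_T_remove[OF z(1)] by simp
    then have nbA: "U + (real t - 1) * x q powr \<theta> \<le> t * dens S (nb S A)"
      using dens_slices[OF nb_subset i fin, of A] t by (simp add: F_def)
    have te1: "t * (2 * e) \<le> 1" using te \<rho> by simp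
    \<comment> \<open>The powers are linearised around \<open>1 / t\<close> by factoring it out and
      comparing \<open>y powr \<theta>\<close> with \<open>y\<close> below and above 1.\<close>
    have "(real t - 1) / t * (1 - t * (2 * e)) \<le> (1 / t) powr \<theta> * (1 - t * (2 * e)) powr \<theta>"
      unfolding inverse_powr_\<theta> using te1 t e by (intro mult_left_mono powr_\<theta>_ge) auto
    also have "\<dots> = (1 / t - 2 * e) powr \<theta>"
      using t te1 by (subst powr_mult[symmetric]) (auto simp: field_simps)
    also have "\<dots> \<le> x q powr \<theta>"
    proof (rule powr_mono2)
      show "0 \<le> 1 / t - 2 * e" using te1 t by (simp add: field_simps)
      show "1 / t - 2 * e \<le> x q" using osc a_near a_le by linarith
    qed (use \<theta>_pos in simp)
    finally have xq_ge: "(real t - 1) / t * (1 - t * (2 * e)) \<le> x q powr \<theta>" .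
    have "a powr \<theta> \<le> (1 / t + e) powr \<theta>"
      using a_near a_avg x_nonneg t \<theta>_pos by (intro powr_mono2) (auto intro!: divide_nonneg_nonneg sum_nonneg)
    also have "\<dots> = (1 / t) powr \<theta> * (1 + t * e) powr \<theta>"
      using t e by (subst powr_mult[symmetric]) (auto simp: field_simps)
    also have "\<dots> \<le> (real t - 1) / t * (1 + t * e)"
      unfolding inverse_powr_\<theta> using t e by (intro mult_left_mono powr_\<theta>_le) auto
    finally have a_powr: "a powr \<theta> \<le> (real t - 1) / t * (1 + t * e)" .
    define s where "s = (real t - 1) / t"
    have s: "0 \<le> s" "s \<le> 1" "t * s = real t - 1" using t by (auto simp: s_def)
    have "(real t - 1) * (s * (1 - t * (2 * e))) \<le> (real t - 1) * x q powr \<theta>"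
      using xq_ge t unfolding s_def by (intro mult_left_mono) auto
    moreover have "t * a powr \<theta> \<le> t * (s * (1 + t * e))"
      using a_powr t unfolding s_def by (intro mult_left_mono) auto
    ultimately have "s + \<rho> + (real t - 1) * (s * (1 - t * (2 * e))) - t * (s * (1 + t * e))
        \<le> t * (dens S (nb S A) - a powr \<theta>)"
      using nbA U by (simp add: s_def right_diff_distrib)
    moreover have "s + \<rho> + (real t - 1) * (s * (1 - t * (2 * e))) - t * (s * (1 + t * e))
        = \<rho> - s * (3 * (t * (t * e)) - 2 * (t * e))"
      by (simp add: algebra_simps)
    moreover have "s * (3 * (t * (t * e)) - 2 * (t * e)) \<le> 1 * (3 * (t * (t * e)))"
      using s e t by (intro mult_mono) (auto simp: algebra_simps)
    \<comment> \<open>Linearisation errors consume at most \<open>3 * \<rho> / 8\<close> of the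
      surplus, while smallness permits only \<open>t * e \<le> \<rho> / 8\<close> in total.\<close>
    ultimately have "\<rho> - 3 * (\<rho> / 8) \<le> t * (dens S (nb S A) - a powr \<theta>)"
      using tte by linarith
    moreover have "dens S (nb S A) - a powr \<theta> \<le> e"
      using small d c unfolding a_def by (smt (verit) abs_ge_zero mult_nonneg_nonneg)
    then have "t * (dens S (nb S A) - a powr \<theta>) \<le> t * e"
      using t by (intro mult_left_mono) auto
    ultimately show False using te \<rho> by linarith
  qed
  show thesis
  proof
    show "\<exists>i\<in>S. \<exists>v\<in>T. 1 - \<rho> < dens (S - {i}) (slice i v A)"
      if "finite S" "A \<subseteq> grid S" "dens S (nb S A) - dens S A powr \<theta> < d - c * \<bar>dens S A - 1 / t\<bar>" for S A
      using that
    proof (induction S arbitrary: A rule: finite_induct)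
      case empty
      then have "A = {} \<or> A = grid {}" by (auto simp: grid_empty)
      then have *: "dens {} A = 0 \<or> dens {} A = 1"
        using dens_grid[of "{}"] by auto
      \<comment> \<open>Densities 0 and 1 are so far from \<open>1 / t\<close> that the allowance is
        not positive, contradicting isoperimetry.\<close>
      have "e \<le> \<bar>dens {} A - 1 / t\<bar>"
      proof -
        have "e \<le> 1 / t" using t \<rho> te by (simp add: le_divide_eq mult.commute)
        moreover have "1 / t \<le> 1 - 1 / t" using t by (simp add: field_simps)
        ultimately show ?thesis using * by (elim disjE) linarith+
      qed
      then have "d \<le> c * \<bar>dens {} A - 1 / t\<bar>"
        unfolding d_def using c by (intro mult_left_mono) auto
      then show ?case
        using isoperimetry[of "{}" A] empty by simp
    next
      case (insert i F)
      have "insert i F - {i} = F" using insert by auto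
      then show ?case
        using insert by (intro step[of "insert i F" A i]) auto
    qed
  qed (use c d in auto)
qed

section \<open>From rough to sharp stability\<close>

lemma powr_le_if_le_root:
  fixes x y k :: real
  assumes "0 < k" "0 \<le> y" "0 \<le> x" "x \<le> y powr (1 / k)"
  shows "x powr k \<le> y"
proof -
  have "x powr k \<le> (y powr (1 / k)) powr k" using assms by (intro powr_mono2) auto
  also have "\<dots> = y" using assms by (simp add: powr_powr)
  finally show ?thesis .
qed

lemma eta_gt_1: "1 < eta t"
  using \<theta>_pos \<theta>_less_1 by (simp add: eta_eq)

text \<open>With \<open>a\<close> the largest slice density outside \<open>v\<close>, the condition
  on \<open>\<rho>\<close> bounds \<open>(t - 1) * a\<close> by
  \<open>(1 - 4 powr (- \<theta>)) * a powr \<theta>\<close>. Hence \<open>\<epsilon>\<close> is at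
  least \<open>4 powr (- \<theta>) * a powr \<theta>\<close>, and raising to the power
  \<open>eta t = 1 / \<theta>\<close> produces the factor 4.\<close>

lemma dens_outside_dense_slice:
  fixes \<rho> :: real
  assumes \<rho>: "(real t - 1) * \<rho> powr (eta t - 1) \<le> 1 - 4 powr (- \<theta>)"
    and I: "finite S" "I \<subseteq> grid S" "I \<inter> nb S I = {}"
    and i: "i \<in> S" and v: "v \<in> T" and dense: "1 - \<rho> < dens (S - {i}) (slice i v I)"
  shows "dens S (I - {x \<in> grid S. x i = v}) \<le> 4 * (1 - t * dens S I) powr eta t"
proof -
  define F where "F = S - {i}"
  define a where "a w = dens F (slice i w I)" for w
  define J where "J = {x \<in> grid S. x i = v}"
  define \<epsilon> where "\<epsilon> = 1 - t * dens S I"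
  have t: "3 \<le> real t" using t_ge_3 by simp
  have finF: "finite F" using I by (simp add: F_def)
  have sub: "slice i w I \<subseteq> grid F" for w
    unfolding F_def by (rule slice_subset[OF I(2) i])
  have a_nonneg: "0 \<le> a w" for w by (simp add: a_def dens_nonneg)
  obtain w where w: "w \<in> T - {v}" "\<And>z. z \<in> T - {v} \<Longrightarrow> a z \<le> a w"
    using argmax_on[of "T - {v}" a] T_remove_nonempty[OF v] by auto
  have sum_le: "(\<Sum>z\<in>T - {v}. a z) \<le> (real t - 1) * a w"
    using sum_mono[of "T - {v}" a "\<lambda>_. a w"] w card_T_remove[OF v] by simp
  have "dens S (I - J) = (\<Sum>z\<in>T. dens F (slice i z (I - J))) / t"
    unfolding F_def using I i by (intro dens_slices) auto
  also have "(\<Sum>z\<in>T. dens F (slice i z (I - J))) = (\<Sum>z\<in>T - {v}. dens F (slice i z (I - J)))"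
  proof -
    have "slice i v (I - J) = {}"
      using I by (auto simp: slice_def J_def)
    then show ?thesis using sum_T_split[OF v] by simp
  qed
  also have "\<dots> \<le> (\<Sum>z\<in>T - {v}. a z)"
    unfolding a_def using sub finF by (intro sum_mono dens_mono slice_mono) auto
  also have "\<dots> \<le> t * a w" using sum_le a_nonneg[of w] by (simp add: algebra_simps)
  finally have IJ: "dens S (I - J) \<le> a w" using t by (simp add: divide_right_mono)
  have "nb F (slice i w I) \<subseteq> slice i v (nb S I)"
    using w slice_nb[OF I(2) i v] unfolding F_def by blast
  moreover have "slice i v (nb S I) \<inter> slice i v I = {}"
    using I(3) by (auto simp: slice_def)
  ultimately have "dens F (nb F (slice i w I)) + a v \<le> 1"
    unfolding a_def using finF sub by (intro dens_disjoint nb_subset) auto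
  moreover have "a w powr \<theta> \<le> dens F (nb F (slice i w I))"
    unfolding a_def by (rule isoperimetry[OF finF sub])
  ultimately have av: "a w powr \<theta> + a v \<le> 1" by linarith
  then have small: "a w powr \<theta> \<le> \<rho>" using dense by (simp add: a_def F_def)
  \<comment> \<open>Splitting off one factor \<open>a w powr \<theta>\<close> leaves a positive
    power, as \<open>eta t > 1\<close>, which \<open>\<rho>\<close> makes small.\<close>
  have aw: "a w = (a w powr \<theta>) powr eta t"
    using a_nonneg[of w] \<theta>_pos by (simp add: eta_eq powr_powr)
  also have "\<dots> = a w powr \<theta> * (a w powr \<theta>) powr (eta t - 1)"
    by (cases "a w = 0") (simp_all add: powr_diff)
  also have "\<dots> \<le> a w powr \<theta> * \<rho> powr (eta t - 1)"
    using small eta_gt_1 by (intro mult_left_mono powr_mono2) auto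
  finally have "(real t - 1) * a w \<le> (real t - 1) * (a w powr \<theta> * \<rho> powr (eta t - 1))"
    using t by (intro mult_left_mono) auto
  also have "\<dots> = a w powr \<theta> * ((real t - 1) * \<rho> powr (eta t - 1))" by simp
  also have "\<dots> \<le> a w powr \<theta> * (1 - 4 powr (- \<theta>))"
    using \<rho> by (intro mult_left_mono) auto
  finally have "a w powr \<theta> * 4 powr (- \<theta>) \<le> a w powr \<theta> - (real t - 1) * a w"
    by (simp add: algebra_simps)
  also have "\<dots> \<le> 1 - a v - (\<Sum>z\<in>T - {v}. a z)" using av sum_le by linarith
  also have "\<dots> = \<epsilon>"
    using dens_slices[OF I(2) i I(1)] sum_T_split[OF v, of a] t
    by (simp add: \<epsilon>_def a_def F_def)
  finally have "a w powr \<theta> * 4 powr (- \<theta>) \<le> \<epsilon>" .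
  then have "(a w powr \<theta> * 4 powr (- \<theta>)) powr eta t \<le> \<epsilon> powr eta t"
    using eta_gt_1 by (intro powr_mono2) auto
  moreover have "(a w powr \<theta> * 4 powr (- \<theta>)) powr eta t = a w / 4"
    unfolding powr_mult aw[symmetric] using \<theta>_pos by (simp add: powr_powr eta_eq)
  ultimately show ?thesis using IJ by (simp add: J_def \<epsilon>_def)
qed

lemma dens_dictator:
  assumes "finite S" "i \<in> S" "v \<in> T"
  shows "dens S {x \<in> grid S. x i = v} = 1 / t"
proof -
  let ?J = "{x \<in> grid S. x i = v}"
  have "slice i w ?J = {}" if "w \<noteq> v" for w
    using that by (auto simp: slice_def)
  moreover have "slice i v ?J = grid (S - {i})"
  proof
    show "slice i v ?J \<subseteq> grid (S - {i})" using assms by (intro slice_subset) auto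
    show "grid (S - {i}) \<subseteq> slice i v ?J"
      using assms by (auto simp: slice_def grid_def PiE_iff extensional_def)
  qed
  ultimately have "(\<Sum>w\<in>T. dens (S - {i}) (slice i w ?J)) = 1"
    using sum_T_split[OF assms(3), of "\<lambda>w. dens (S - {i}) (slice i w ?J)"] assms
    by (simp add: dens_grid)
  then show ?thesis
    using dens_slices[of ?J S i] assms by auto
qed

lemma dictator_independent: "i \<in> S \<Longrightarrow> {x \<in> grid S. x i = v} \<inter> nb S {x \<in> grid S. x i = v} = {}"
  by (auto simp: nb_def)

lemma stability:
  obtains \<epsilon>0 where "0 < \<epsilon>0"
    "\<And>S I. \<lbrakk>finite S; I \<subseteq> grid S; I \<inter> nb S I = {}; 1 - t * dens S I < \<epsilon>0\<rbrakk> \<Longrightarrow>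
      \<exists>i\<in>S. \<exists>v\<in>T. dens S (I - {x \<in> grid S. x i = v}) \<le> 4 * (1 - t * dens S I) powr eta t"
proof -
  have t: "3 \<le> real t" using t_ge_3 by simp
  define \<kappa> where "\<kappa> = (1 - 4 powr (- \<theta>)) / (real t - 1)"
  have "4 powr (- \<theta>) < 4 powr 0" using \<theta>_pos by (intro powr_less_mono) auto
  then have \<kappa>: "0 < \<kappa>" using t by (simp add: \<kappa>_def)
  \<comment> \<open>The second entry gives the condition of \<open>dens_outside_dense_slice\<close>.
    The third gives that of \<open>near_extremal_has_dense_slice\<close>, rewritten as a bound on
    \<open>(\<rho> / (2 * t)) powr (1 - \<theta>)\<close>.\<close>
  define \<rho> where "\<rho> = min (1 / 2) (min (\<kappa> powr (1 / (eta t - 1)))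
    (2 * real t * (1 / (4 * real t ^ 2)) powr (1 / (1 - \<theta>))))"
  have \<rho>: "0 < \<rho>" "\<rho> < 1" using \<kappa> t by (auto simp: \<rho>_def)
  have "\<rho> powr (eta t - 1) \<le> \<kappa>"
    using \<rho> \<kappa> eta_gt_1 by (intro powr_le_if_le_root) (auto simp: \<rho>_def)
  then have \<rho>1: "(real t - 1) * \<rho> powr (eta t - 1) \<le> 1 - 4 powr (- \<theta>)"
    using t by (simp add: \<kappa>_def field_simps)
  have "\<rho> \<le> 2 * real t * (1 / (4 * real t ^ 2)) powr (1 / (1 - \<theta>))"
    by (simp add: \<rho>_def)
  then have "\<rho> / (2 * t) \<le> (1 / (4 * real t ^ 2)) powr (1 / (1 - \<theta>))"
    using t by (simp add: field_simps)
  then have "(\<rho> / (2 * t)) powr (1 - \<theta>) \<le> 1 / (4 * real t ^ 2)"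
    using \<theta>_less_1 t \<rho> by (intro powr_le_if_le_root) auto
  then have "(\<rho> / (2 * t)) powr \<theta> * (\<rho> / (2 * t)) powr (1 - \<theta>) \<le> (\<rho> / (2 * t)) powr \<theta> * (1 / (4 * real t ^ 2))"
    by (intro mult_left_mono) auto
  moreover have "(\<rho> / (2 * t)) powr \<theta> * (\<rho> / (2 * t)) powr (1 - \<theta>) = \<rho> / (2 * t)"
    using \<rho> t by (simp flip: powr_add)
  ultimately have "4 * real t ^ 2 * (\<rho> / (2 * t)) \<le> (\<rho> / (2 * t)) powr \<theta>"
    using t by (simp add: le_divide_eq mult.commute)
  moreover have "4 * real t ^ 2 * (\<rho> / (2 * t)) = 2 * t * \<rho>"
    using t by (simp add: power2_eq_square)
  ultimately have \<rho>2: "2 * t * \<rho> \<le> (\<rho> / (2 * t)) powr \<theta>" by simp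
  obtain c d where cd: "0 < c" "0 < d"
    "\<And>S A. \<lbrakk>finite S; A \<subseteq> grid S;
        dens S (nb S A) - dens S A powr \<theta> < d - c * \<bar>dens S A - 1 / t\<bar>\<rbrakk>
      \<Longrightarrow> \<exists>i\<in>S. \<exists>v\<in>T. 1 - \<rho> < dens (S - {i}) (slice i v A)"
    using near_extremal_has_dense_slice[OF \<rho> \<rho>2] by blast
  show thesis
  proof
    \<comment> \<open>The excess of \<open>I\<close> is at most \<open>\<epsilon>\<close> and the
      density penalty at most \<open>c * \<epsilon>\<close>, so
      \<open>(1 + c) * \<epsilon> < d\<close> suffices.\<close>
    show "0 < d / (1 + c)" using cd by simp
    fix S I assume I: "finite S" "I \<subseteq> grid S" "I \<inter> nb S I = {}" and less: "1 - t * dens S I < d / (1 + c)"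
    define \<epsilon> where "\<epsilon> = 1 - t * dens S I"
    have dens_I: "dens S I = 1 / t * (1 - \<epsilon>)" using t by (simp add: \<epsilon>_def)
    have \<epsilon>: "0 \<le> \<epsilon>" "\<epsilon> \<le> 1"
      using dens_independent_le[OF I] dens_nonneg[of S I] t by (simp_all add: \<epsilon>_def field_simps)
    have "dens S I powr \<theta> = (real t - 1) / t * (1 - \<epsilon>) powr \<theta>"
      using \<epsilon> t by (simp only: dens_I powr_mult inverse_powr_\<theta>)
    moreover have "(real t - 1) / t * (1 - \<epsilon>) \<le> (real t - 1) / t * (1 - \<epsilon>) powr \<theta>"
      using \<epsilon> t by (intro mult_left_mono powr_\<theta>_ge) auto
    moreover have "dens S (nb S I) \<le> 1 - 1 / t * (1 - \<epsilon>)"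
      using dens_disjoint[OF I(2) nb_subset I(1,3)] dens_I by simp
    moreover have "1 - 1 / t * (1 - \<epsilon>) - (real t - 1) / t * (1 - \<epsilon>) = \<epsilon>"
      using t by (simp add: field_simps)
    ultimately have "dens S (nb S I) - dens S I powr \<theta> \<le> \<epsilon>" by linarith
    moreover have "\<bar>dens S I - 1 / t\<bar> = \<epsilon> / t"
      using \<epsilon> t by (simp add: dens_I abs_if field_simps)
    then have "c * \<bar>dens S I - 1 / t\<bar> \<le> c * \<epsilon>"
      using cd t \<epsilon> by (intro mult_left_mono) (auto simp: divide_le_eq mult_le_cancel_left1)
    moreover have "\<epsilon> + c * \<epsilon> < d"
      using less cd by (simp add: \<epsilon>_def[symmetric] less_divide_eq algebra_simps)
    ultimately have "dens S (nb S I) - dens S I powr \<theta> < d - c * \<bar>dens S I - 1 / t\<bar>"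
      by linarith
    then obtain i v where "i \<in> S" "v \<in> T" "1 - \<rho> < dens (S - {i}) (slice i v I)"
      using cd(3)[OF I(1,2)] by blast
    then show "\<exists>i\<in>S. \<exists>v\<in>T. dens S (I - {x \<in> grid S. x i = v}) \<le> 4 * (1 - t * dens S I) powr eta t"
      using dens_outside_dense_slice[OF \<rho>1 I] by blast
  qed
qed

section \<open>Transfer to the graph on the cube\<close>

lemma independent_set_iff:
  "independent_set (cube t n) (K_adj n) I \<longleftrightarrow> I \<subseteq> grid {1..n} \<and> I \<inter> nb {1..n} I = {}"
  by (auto simp: independent_set_def cube_def K_adj_def grid_def nb_def T_def) blast+

lemma mu_eq_dens: "mu t n A = dens {1..n} A"
  by (simp add: mu_def dens_def)

end

theorem theorem1p4:
  fixes t :: nat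
  assumes "t \<ge> 3"
  shows "\<exists>\<epsilon>\<^sub>t::real. \<epsilon>\<^sub>t > 0 \<and>
    (\<forall>(n::nat) I (\<epsilon>::real).
       n \<ge> 1 \<and> independent_set (cube t n) (K_adj n) I \<and>
       \<epsilon> = 1 - real t * mu t n I \<and> \<epsilon> < \<epsilon>\<^sub>t \<longrightarrow>
       (\<exists>J. maximum_independent_set (cube t n) (K_adj n) J \<and> mu t n J = 1 / real t \<and>
            mu t n (I - J) \<le> 4 * \<epsilon> powr eta t))"
proof -
  interpret alphabet t using assms by unfold_locales
  obtain \<epsilon>0 where \<epsilon>0: "0 < \<epsilon>0"
    "\<And>S I. \<lbrakk>finite S; I \<subseteq> grid S; I \<inter> nb S I = {}; 1 - t * dens S I < \<epsilon>0\<rbrakk> \<Longrightarrow>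
      \<exists>i\<in>S. \<exists>v\<in>T. dens S (I - {x \<in> grid S. x i = v}) \<le> 4 * (1 - t * dens S I) powr eta t"
    using stability by blast
  show ?thesis
  proof (intro exI[of _ \<epsilon>0] conjI allI impI)
    fix n I \<epsilon>
    assume *: "n \<ge> 1 \<and> independent_set (cube t n) (K_adj n) I \<and>
       \<epsilon> = 1 - real t * mu t n I \<and> \<epsilon> < \<epsilon>0"
    obtain i v where iv: "i \<in> {1..n}" "v \<in> T"
      "dens {1..n} (I - {x \<in> grid {1..n}. x i = v}) \<le> 4 * \<epsilon> powr eta t"
      using \<epsilon>0(2)[of "{1..n}" I] * by (auto simp: independent_set_iff mu_eq_dens)
    define J where "J = {x \<in> grid {1..n}. x i = v}"
    have J: "dens {1..n} J = 1 / t"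
      using dens_dictator[OF _ iv(1,2)] by (simp add: J_def)
    have "card A \<le> card J" if "independent_set (cube t n) (K_adj n) A" for A
    proof -
      have "dens {1..n} A \<le> dens {1..n} J"
        unfolding J using that by (intro dens_independent_le) (auto simp: independent_set_iff)
      then show ?thesis using assms by (simp add: dens_def divide_le_cancel)
    qed
    moreover have "independent_set (cube t n) (K_adj n) J"
      using dictator_independent[OF iv(1)] by (auto simp: independent_set_iff J_def)
    ultimately have "maximum_independent_set (cube t n) (K_adj n) J"
      by (simp add: maximum_independent_set_def)
    then show "\<exists>J. maximum_independent_set (cube t n) (K_adj n) J \<and> mu t n J = 1 / real t \<and>
            mu t n (I - J) \<le> 4 * \<epsilon> powr eta t"
      using J iv(3) by (auto simp: mu_eq_dens J_def)
  qed (rule \<epsilon>0(1))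
qed

end
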